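(* Let $\nu>-1$, $m>-1$, $0<\gamma<1$ and $\gamma<\theta<1$. Then for all $x>0$, $$\int_0^x e^{-\gamma t}\,t^m\,\frac{I_\nu(t)}{t^\nu}\,dt\le M_{\nu,m,\gamma}(\theta)\,e^{-\gamma x}\,x^m\,\frac{I_{\nu+1}(x)}{x^\nu}.$$ For $m\ge0$ the constant is $$M_{\nu,m,\gamma}(\theta)=\max\left\{K_{\nu,m}\exp\left(\frac{2\gamma(\nu+2)\theta}{1-\theta}\right),\ \frac{\nu+1+\theta}{(\nu+2)\theta(\theta-\gamma)}\right\}.$$
   Context: $I_\alpha(x)=\sum_{k=0}^{\infty}\frac{(x/2)^{2k+\alpha}}{k!\,\Gamma(k+\alpha+1)}$, $x>0$, is the modified Bessel function of the first kind. For $\mu>-1$, $q>-1$, $0<\gamma<\theta<1$: $K_{\mu,q}=\max\{1,\frac{2(\mu+1)}{q+1}\}$; $X_{\mu,q}(\theta)=\frac{2(\mu+2)\theta}{1-\theta}$ if $q\ge0$, and if $-1<q<0$, $$X_{\mu,q}(\theta)=\max\left\{\frac{2(\mu+2)\theta}{1-\theta},\ \frac{(2\mu+2)\theta-q+\sqrt{\{(2\mu+2)\theta-q\}^2-4(1-\theta)q(2\mu+2)}}{2(1-\theta)}\right\};$$ $\beta_{\mu,q}(\theta)=\frac{X_{\mu,q}(\theta)}{X_{\mu,q}(\theta)+2\mu+2}$; and $M_{\mu,q,\gamma}(\theta)=\max\left\{K_{\mu,q}\exp(\gamma X_{\mu,q}(\theta)),\ \frac{1}{\beta_{\mu,q}(\theta)(\theta-\gamma)}\right\}$.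 *)

theory Defs
  imports "HOL-Analysis.Analysis"
begin

text \<open>
  The modified Bessel function of the first kind, for real order and \<open>x > 0\<close>.
  Since \<open>Gamma\<close> is \<open>0\<close> at its poles and \<open>c / 0 = 0\<close>, the terms with
  \<open>k + \<alpha> + 1\<close> a nonpositive integer vanish, as is customary.
\<close>

definition bessel_I :: "real \<Rightarrow> real \<Rightarrow> real" where
  "bessel_I \<alpha> x =
     (\<Sum>k. (x / 2) powr (2 * real k + \<alpha>) / (fact k * Gamma (real k + \<alpha> + 1)))"

definition K_const :: "real \<Rightarrow> real \<Rightarrow> real" where
  "K_const \<mu> q = max 1 (2 * (\<mu> + 1) / (q + 1))"

definition X_const :: "real \<Rightarrow> real \<Rightarrow> real \<Rightarrow> real" where
  "X_const \<mu> q \<theta> =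
     (if q \<ge> 0 then 2 * (\<mu> + 2) * \<theta> / (1 - \<theta>)
      else max (2 * (\<mu> + 2) * \<theta> / (1 - \<theta>))
             (((2 * \<mu> + 2) * \<theta> - q
                + sqrt (((2 * \<mu> + 2) * \<theta> - q)\<^sup>2 - 4 * (1 - \<theta>) * q * (2 * \<mu> + 2)))
              / (2 * (1 - \<theta>))))"

definition beta_const :: "real \<Rightarrow> real \<Rightarrow> real \<Rightarrow> real" where
  "beta_const \<mu> q \<theta> = X_const \<mu> q \<theta> / (X_const \<mu> q \<theta> + 2 * \<mu> + 2)"

definition M_const :: "real \<Rightarrow> real \<Rightarrow> real \<Rightarrow> real \<Rightarrow> real" where
  "M_const \<mu> q \<gamma> \<theta> =
     max (K_const \<mu> q * exp (\<gamma> * X_const \<mu> q \<theta>))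
         (1 / (beta_const \<mu> q \<theta> * (\<theta> - \<gamma>)))"

end

theory Submission
  imports Defs
begin

text \<open>
  Write \<open>J\<^sub>a(t) = t\<^sup>-\<^sup>a I\<^sub>a(t)\<close>, an even entire function of \<open>t\<close>. It satisfies
  \<open>J\<^sub>a' = t J\<^sub>a\<^sub>+\<^sub>1\<close> and \<open>J\<^sub>a = 2(a+1) J\<^sub>a\<^sub>+\<^sub>1 + t\<^sup>2 J\<^sub>a\<^sub>+\<^sub>2\<close>. The integrand is
  \<open>e\<^sup>-\<^sup>\<gamma>\<^sup>t t\<^sup>m J\<^sub>\<nu>(t)\<close>, and the right-hand side is a multiple of \<open>e\<^sup>-\<^sup>\<gamma>\<^sup>x P(x)\<close> with
  \<open>P(t) = t\<^sup>m\<^sup>+\<^sup>1 J\<^sub>\<nu>\<^sub>+\<^sub>1(t)\<close>, which vanishes at \<open>0\<close>. So it is enough to compare derivatives,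
  and \<open>P'(t) = t\<^sup>m ((m+1) J\<^sub>\<nu>\<^sub>+\<^sub>1 + t\<^sup>2 J\<^sub>\<nu>\<^sub>+\<^sub>2)\<close>.

  On \<open>(0, X]\<close> the exponential weight is harmless. The constant \<open>K\<close> is the one for which
  \<open>K P' \<ge> t\<^sup>m J\<^sub>\<nu>\<close> can be read off the recurrence coefficient by coefficient, whence
  \<open>\<integral>\<^sub>0\<^sup>x e\<^sup>-\<^sup>\<gamma>\<^sup>t t\<^sup>m J\<^sub>\<nu> dt \<le> K P(x) \<le> K e\<^sup>\<gamma>\<^sup>X e\<^sup>-\<^sup>\<gamma>\<^sup>x P(x)\<close>
  (lemma \<open>integral_near\<close>).

  On \<open>[X, \<infinity>)\<close> the weighted function \<open>e\<^sup>-\<^sup>\<gamma>\<^sup>t P(t)\<close> is differentiated itself, which costs a term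
  \<open>- \<gamma> t J\<^sub>\<nu>\<^sub>+\<^sub>1\<close>. The inequality \<open>I\<^sub>a\<^sub>+\<^sub>1 \<le> I\<^sub>a\<close> for \<open>a \<ge> -1/2\<close>
  (lemma \<open>reduced_bessel_step_le\<close>), fed back into the recurrence, bounds the ratio of consecutive
  functions: \<open>J\<^sub>a \<le> (2(a+1) + t) J\<^sub>a\<^sub>+\<^sub>1\<close>. With \<open>a = \<nu> + 1\<close> it says that
  \<open>t J\<^sub>\<nu>\<^sub>+\<^sub>2 \<ge> \<theta> J\<^sub>\<nu>\<^sub>+\<^sub>1\<close> as soon as \<open>t \<ge> 2(\<nu>+2)\<theta>/(1-\<theta>)\<close>, so that the derivative,
  up to the common factor \<open>e\<^sup>-\<^sup>\<gamma>\<^sup>t t\<^sup>m\<close>, is at least \<open>(\<theta> - \<gamma>) t J\<^sub>\<nu>\<^sub>+\<^sub>1\<close>; with \<open>a = \<nu>\<close> it says that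
  \<open>t J\<^sub>\<nu>\<^sub>+\<^sub>1 \<ge> \<beta> J\<^sub>\<nu>\<close>, where \<open>\<beta>\<close> is the value at \<open>t = X\<close> of the increasing function
  \<open>t/(t + 2\<nu> + 2)\<close>. Together they give the constant \<open>1/(\<beta>(\<theta>-\<gamma>))\<close>
  (lemma \<open>derivative_dominates_far\<close>).
\<close>

section \<open>The Bessel--Clifford function\<close>

text \<open>
  The reduced Bessel function \<open>t\<^sup>-\<^sup>a I\<^sub>a(t)\<close> is a power series in \<open>z = t\<^sup>2/4\<close>. Working with that
  series makes termwise differentiation available and avoids real powers at \<open>0\<close>.
\<close>

definition bessel_clifford :: "real \<Rightarrow> real \<Rightarrow> real" where
  "bessel_clifford a z = (\<Sum>k. inverse (fact k * Gamma (real k + a + 1)) * z ^ k)"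

lemma Gamma_plus1_pos:
  fixes x :: real
  assumes "x > 0"
  shows "Gamma (x + 1) = x * Gamma x"
proof (rule Gamma_plus1)
  show "x \<notin> \<int>\<^sub>\<le>\<^sub>0" using assms by (auto elim!: nonpos_Ints_cases)
qed

lemma summable_bessel_clifford:
  fixes a z :: real
  assumes "a > -1"
  shows "summable (\<lambda>k. inverse (fact k * Gamma (real k + a + 1)) * z ^ k)"
proof -
  obtain N :: nat where N: "real N \<ge> 2 * \<bar>z\<bar>" "N \<ge> 1"
    using real_arch_simple[of "max 1 (2 * \<bar>z\<bar>)"] by auto
  show ?thesis
  proof (rule summable_ratio_test[where c = "1/2" and N = N])
    fix n assume n: "n \<ge> N"
    define A where "A = inverse (fact n * Gamma (real n + a + 1)) * z ^ n"
    have pos: "real n + a + 1 > 0" using assms n N(2) by linarith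
    have G: "Gamma (real (Suc n) + a + 1) = (real n + a + 1) * Gamma (real n + a + 1)"
      using Gamma_plus1_pos[OF pos] by (simp add: add_ac)
    have step: "inverse (fact (Suc n) * Gamma (real (Suc n) + a + 1)) * z ^ Suc n
        = z / ((real n + 1) * (real n + a + 1)) * A"
      unfolding G A_def using pos by (simp add: field_simps)
    have "2 * \<bar>z\<bar> \<le> real n" using n N by linarith
    also have "\<dots> \<le> (real n + 1) * (real n + a + 1)"
    proof -
      have "(real n + 1) * real n \<le> (real n + 1) * (real n + a + 1)"
        using assms by (intro mult_left_mono) auto
      moreover have "real n \<le> (real n + 1) * real n" by (simp add: algebra_simps)
      ultimately show ?thesis by linarith
    qed
    finally have "2 * \<bar>z\<bar> \<le> (real n + 1) * (real n + a + 1)" .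
    moreover have "(real n + 1) * (real n + a + 1) > 0" using pos by simp
    ultimately have "\<bar>z / ((real n + 1) * (real n + a + 1))\<bar> \<le> 1 / 2"
      by (simp only: abs_divide abs_of_pos pos_divide_le_eq)
    then have "\<bar>z / ((real n + 1) * (real n + a + 1)) * A\<bar> \<le> 1 / 2 * \<bar>A\<bar>"
      unfolding abs_mult by (rule mult_right_mono) auto
    then show "norm (inverse (fact (Suc n) * Gamma (real (Suc n) + a + 1)) * z ^ Suc n)
        \<le> 1 / 2 * norm (inverse (fact n * Gamma (real n + a + 1)) * z ^ n)"
      unfolding step A_def by simp
  qed simp
qed

lemma bessel_clifford_nonneg:
  assumes "a > -1" "z \<ge> 0"
  shows "bessel_clifford a z \<ge> 0"
  unfolding bessel_clifford_def
  using assms by (intro suminf_nonneg summable_bessel_clifford)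
    (auto intro!: mult_nonneg_nonneg Gamma_real_nonneg)

lemma diffs_bessel_clifford:
  "diffs (\<lambda>k. inverse (fact k * Gamma (real k + a + 1)))
    = (\<lambda>k. inverse (fact k * Gamma (real k + (a + 1) + 1)))"
  proof
  fix k
  have "real (Suc k) + a + 1 = real k + (a + 1) + 1" by simp
  then show "diffs (\<lambda>k. inverse (fact k * Gamma (real k + a + 1))) k
      = inverse (fact k * Gamma (real k + (a + 1) + 1))"
    unfolding diffs_def by (simp only: fact_Suc inverse_mult_distrib) simp
qed

lemma has_real_derivative_bessel_clifford:
  assumes "a > -1"
  shows "(bessel_clifford a has_real_derivative bessel_clifford (a + 1) z) (at z)"
  using termdiffs_strong_converges_everywhere[of "\<lambda>k. inverse (fact k * Gamma (real k + a + 1))" z]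
    summable_bessel_clifford[OF assms]
  unfolding diffs_bessel_clifford bessel_clifford_def[abs_def] by blast

text \<open>
  Since \<open>1/\<Gamma>(k+a+1) = ((a+1) + k)/\<Gamma>(k+a+2)\<close>, the series splits into \<open>a + 1\<close> times the series of
  order \<open>a + 1\<close> and a series with an additional factor \<open>k\<close>, which is \<open>z\<close> times the one of order
  \<open>a + 2\<close>.
\<close>

lemma bessel_clifford_rec:
  assumes "a > -1"
  shows "bessel_clifford a z = (a + 1) * bessel_clifford (a + 1) z + z * bessel_clifford (a + 2) z"
proof -
  define c where "c = (\<lambda>b k. inverse (fact k * Gamma (real k + b + 1)) :: real)"
  have sums: "(\<lambda>k. c b k * z ^ k) sums bessel_clifford b z" if "b > -1" for b
    unfolding c_def bessel_clifford_def using summable_bessel_clifford[OF that] by (rule summable_sums)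
  have "(\<lambda>k. z * (c (a + 2) k * z ^ k)) sums (z * bessel_clifford (a + 2) z)"
    using assms by (intro sums_mult sums) auto
  moreover have "z * (c (a + 2) k * z ^ k) = real (Suc k) * c (a + 1) (Suc k) * z ^ Suc k" for k
    by (simp add: c_def add_ac field_simps del: of_nat_Suc) (simp add: add_ac)
  ultimately have shifted: "(\<lambda>k. real k * c (a + 1) k * z ^ k) sums (z * bessel_clifford (a + 2) z)"
    using sums_Suc_iff[of "\<lambda>k. real k * c (a + 1) k * z ^ k"] by simp
  have coeff: "c a k = (a + 1) * c (a + 1) k + real k * c (a + 1) k" for k
  proof -
    have pos: "real k + a + 1 > 0" using assms by linarith
    have G: "Gamma (real k + (a + 1) + 1) = (real k + a + 1) * Gamma (real k + a + 1)"
      using Gamma_plus1_pos[OF pos] by (simp add: add_ac)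
    have "Gamma (real k + a + 1) > 0" using pos by (rule Gamma_real_pos)
    moreover have "(a + 1) * inverse (fact k * ((real k + a + 1) * Gamma (real k + a + 1)))
          + real k * inverse (fact k * ((real k + a + 1) * Gamma (real k + a + 1)))
        = (real k + a + 1) * inverse (fact k * ((real k + a + 1) * Gamma (real k + a + 1)))"
      by (simp only: algebra_simps)
    ultimately show ?thesis unfolding c_def G using pos by simp
  qed
  have "(\<lambda>k. (a + 1) * (c (a + 1) k * z ^ k) + real k * c (a + 1) k * z ^ k) sums
      ((a + 1) * bessel_clifford (a + 1) z + z * bessel_clifford (a + 2) z)"
    using assms by (intro sums_add sums_mult sums shifted) auto
  then have "(\<lambda>k. c a k * z ^ k) sums
      ((a + 1) * bessel_clifford (a + 1) z + z * bessel_clifford (a + 2) z)"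
    by (simp add: coeff algebra_simps)
  with sums[OF assms] show ?thesis by (rule sums_unique2)
qed

section \<open>The reduced Bessel function\<close>

definition reduced_bessel :: "real \<Rightarrow> real \<Rightarrow> real" where
  "reduced_bessel a t = 2 powr (- a) * bessel_clifford a ((t / 2)\<^sup>2)"

lemma bessel_I_eq_reduced_bessel:
  assumes "a > -1" "t > 0"
  shows "bessel_I a t = t powr a * reduced_bessel a t"
proof -
  have "(t / 2) powr (2 * real k + a) / (fact k * Gamma (real k + a + 1))
      = (t / 2) powr a * (inverse (fact k * Gamma (real k + a + 1)) * ((t / 2)\<^sup>2) ^ k)" for k
  proof -
    have "(t / 2) powr (2 * real k + a) = (t / 2) powr a * (t / 2) powr (real (2 * k))"
      by (simp add: powr_add)
    also have "(t / 2) powr (real (2 * k)) = ((t / 2)\<^sup>2) ^ k"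
      using assms by (subst powr_realpow) (auto simp: power_mult)
    finally have split: "(t / 2) powr (2 * real k + a) = (t / 2) powr a * ((t / 2)\<^sup>2) ^ k" .
    show ?thesis unfolding split by (simp only: divide_inverse mult_ac)
  qed
  then have "bessel_I a t =
      (\<Sum>k. (t / 2) powr a * (inverse (fact k * Gamma (real k + a + 1)) * ((t / 2)\<^sup>2) ^ k))"
    unfolding bessel_I_def by (simp only:)
  also have "\<dots> = (t / 2) powr a * bessel_clifford a ((t / 2)\<^sup>2)"
    unfolding bessel_clifford_def using summable_bessel_clifford[OF assms(1)] by (rule suminf_mult)
  also have "(t / 2) powr a = t powr a * 2 powr (- a)"
    using assms by (simp add: powr_divide powr_minus_divide)
  finally show ?thesis by (simp add: reduced_bessel_def)
qed

lemma reduced_bessel_nonneg: "a > -1 \<Longrightarrow> reduced_bessel a t \<ge> 0"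
  by (simp add: reduced_bessel_def bessel_clifford_nonneg)

lemma has_real_derivative_reduced_bessel:
  assumes "a > -1"
  shows "(reduced_bessel a has_real_derivative t * reduced_bessel (a + 1) t) (at t)"
proof -
  have "(reduced_bessel a has_real_derivative
      2 powr (- a) * (bessel_clifford (a + 1) ((t / 2)\<^sup>2) * (t / 2))) (at t)"
    unfolding reduced_bessel_def[abs_def]
    by (rule DERIV_cmult, rule DERIV_chain2[OF has_real_derivative_bessel_clifford[OF assms]])
      (auto intro!: derivative_eq_intros)
  moreover have half: "(2::real) powr (- (a + 1)) = 2 powr (- a) / 2"
    by (simp add: powr_diff)
  ultimately show ?thesis unfolding reduced_bessel_def half by (simp add: mult_ac)
qed

lemma continuous_on_reduced_bessel:
  assumes "a > -1"
  shows "continuous_on S (reduced_bessel a)"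
  using has_real_derivative_reduced_bessel[OF assms]
  by (meson DERIV_isCont continuous_at_imp_continuous_on)

lemma reduced_bessel_rec:
  assumes "a > -1"
  shows "reduced_bessel a t = 2 * (a + 1) * reduced_bessel (a + 1) t + t\<^sup>2 * reduced_bessel (a + 2) t"
proof -
  have two_powr: "(2::real) powr (- (a + 1)) = 2 powr (- a) / 2"
      "(2::real) powr (- (a + 2)) = 2 powr (- a) / 4"
    by (simp_all add: powr_diff)
  show ?thesis
    unfolding reduced_bessel_def two_powr bessel_clifford_rec[OF assms, of "(t / 2)\<^sup>2"]
    by (simp add: field_simps power2_eq_square)
qed

text \<open>
  This is \<open>I\<^sub>a\<^sub>+\<^sub>1 \<le> I\<^sub>a\<close> for \<open>a \<ge> -1/2\<close>. The difference \<open>d = J\<^sub>a - t J\<^sub>a\<^sub>+\<^sub>1\<close> satisfies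
  \<open>d' + d = (2a+1) J\<^sub>a\<^sub>+\<^sub>1 \<ge> 0\<close>, so \<open>e\<^sup>t d(t)\<close> increases from \<open>d(0) = J\<^sub>a(0) \<ge> 0\<close>.
\<close>

lemma reduced_bessel_step_le:
  assumes a: "a \<ge> -1/2" and t: "t \<ge> 0"
  shows "t * reduced_bessel (a + 1) t \<le> reduced_bessel a t"
proof -
  define E where "E = (\<lambda>s. exp s * (reduced_bessel a s - s * reduced_bessel (a + 1) s))"
  have "E 0 \<le> E t"
  proof (rule DERIV_nonneg_imp_nondecreasing[OF t])
    fix s :: real assume "0 \<le> s"
    have rec: "reduced_bessel a s
        = 2 * (a + 1) * reduced_bessel (a + 1) s + s\<^sup>2 * reduced_bessel (a + 2) s"
      using a by (intro reduced_bessel_rec) auto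
    have der1: "(reduced_bessel (a + 1) has_real_derivative s * reduced_bessel (a + 2) s) (at s)"
      using has_real_derivative_reduced_bessel[of "a + 1" s] a by (simp add: add_ac)
    have der0: "(reduced_bessel a has_real_derivative s * reduced_bessel (a + 1) s) (at s)"
      using a by (intro has_real_derivative_reduced_bessel) auto
    have "(E has_real_derivative exp s * ((2 * a + 1) * reduced_bessel (a + 1) s)) (at s)"
      unfolding E_def
      by (rule derivative_eq_intros der0 der1 refl)+
        (simp add: rec algebra_simps power2_eq_square)
    moreover have "exp s * ((2 * a + 1) * reduced_bessel (a + 1) s) \<ge> 0"
      using a reduced_bessel_nonneg[of "a + 1" s] by (intro mult_nonneg_nonneg) auto
    ultimately show "\<exists>y. (E has_real_derivative y) (at s) \<and> y \<ge> 0" by blast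
  qed
  moreover have "E 0 \<ge> 0" using reduced_bessel_nonneg[of a 0] a by (simp add: E_def)
  ultimately have "exp t * (reduced_bessel a t - t * reduced_bessel (a + 1) t) \<ge> 0"
    by (simp add: E_def)
  then show ?thesis by (simp add: zero_le_mult_iff)
qed

text \<open>
  Equivalently \<open>I\<^sub>a\<^sub>+\<^sub>1(t)/I\<^sub>a(t) \<ge> t/(t + 2a + 2)\<close>. Through the recurrence this is
  \<open>I\<^sub>a\<^sub>+\<^sub>2 \<le> I\<^sub>a\<^sub>+\<^sub>1\<close>, and thus holds in the whole range \<open>a > -1\<close> although \<open>I\<^sub>a\<^sub>+\<^sub>1 \<le> I\<^sub>a\<close> does not.
\<close>

lemma reduced_bessel_ratio:
  assumes "a > -1" "t \<ge> 0"
  shows "reduced_bessel a t \<le> (2 * (a + 1) + t) * reduced_bessel (a + 1) t"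
proof -
  have "t * (t * reduced_bessel (a + 2) t) \<le> t * reduced_bessel (a + 1) t"
    using reduced_bessel_step_le[of "a + 1" t] assms by (intro mult_left_mono) (auto simp: add_ac)
  then show ?thesis
    unfolding reduced_bessel_rec[OF assms(1)] by (simp add: algebra_simps power2_eq_square)
qed

section \<open>Comparison of derivatives\<close>

lemma has_real_derivative_powr_reduced_bessel:
  assumes "a > -1" "t > 0"
  shows "((\<lambda>t. t powr (m + 1) * reduced_bessel (a + 1) t) has_real_derivative
    t powr m * ((m + 1) * reduced_bessel (a + 1) t + t\<^sup>2 * reduced_bessel (a + 2) t)) (at t)"
proof -
  have der1: "(reduced_bessel (a + 1) has_real_derivative t * reduced_bessel (a + 2) t) (at t)"
    using has_real_derivative_reduced_bessel[of "a + 1" t] assms by (simp add: add_ac)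
  have "((\<lambda>t. t powr (m + 1)) has_real_derivative (m + 1) * t powr m) (at t)"
    using has_real_derivative_powr[of t "m + 1"] assms by simp
  from DERIV_mult[OF this der1] show ?thesis
    using assms by (simp add: powr_add algebra_simps power2_eq_square)
qed

text \<open>
  The recurrence expresses \<open>J\<^sub>\<nu>\<close> with coefficients \<open>2(\<nu>+1)\<close> and \<open>1\<close>, and \<open>K\<close> is the least constant
  for which \<open>K(m+1)\<close> and \<open>K\<close> are at least as large.
\<close>

lemma derivative_dominates_near:
  assumes "\<nu> > -1" "m > -1"
  shows "reduced_bessel \<nu> t
    \<le> K_const \<nu> m * ((m + 1) * reduced_bessel (\<nu> + 1) t + t\<^sup>2 * reduced_bessel (\<nu> + 2) t)"
proof -
  have "2 * (\<nu> + 1) / (m + 1) \<le> K_const \<nu> m" by (simp add: K_const_def)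
  then have "2 * (\<nu> + 1) \<le> K_const \<nu> m * (m + 1)" using assms by (simp add: field_simps)
  then have "2 * (\<nu> + 1) * reduced_bessel (\<nu> + 1) t
      \<le> K_const \<nu> m * (m + 1) * reduced_bessel (\<nu> + 1) t"
    using assms by (intro mult_right_mono reduced_bessel_nonneg) auto
  moreover have "1 * (t\<^sup>2 * reduced_bessel (\<nu> + 2) t) \<le> K_const \<nu> m * (t\<^sup>2 * reduced_bessel (\<nu> + 2) t)"
    using assms by (intro mult_right_mono mult_nonneg_nonneg reduced_bessel_nonneg)
      (auto simp: K_const_def)
  ultimately show ?thesis
    unfolding reduced_bessel_rec[OF assms(1), of t] by (simp add: algebra_simps)
qed

text \<open>
  Beyond \<open>X\<close> the term \<open>t\<^sup>2 J\<^sub>\<nu>\<^sub>+\<^sub>2\<close> alone outweighs the loss \<open>\<gamma> t J\<^sub>\<nu>\<^sub>+\<^sub>1\<close> from differentiating the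
  exponential, by the ratio bound of order \<open>\<nu> + 1\<close>. The ratio bound of order \<open>\<nu>\<close> then returns from
  \<open>J\<^sub>\<nu>\<^sub>+\<^sub>1\<close> to \<open>J\<^sub>\<nu>\<close>.
\<close>

lemma derivative_dominates_far:
  assumes \<nu>: "\<nu> > -1" and m: "m > -1" and \<gamma>: "\<gamma> < \<theta>" and \<theta>: "0 < \<theta>" "\<theta> < 1"
    and X: "2 * (\<nu> + 2) * \<theta> / (1 - \<theta>) \<le> X" and t: "X \<le> t"
    and M: "1 / (X / (X + 2 * \<nu> + 2) * (\<theta> - \<gamma>)) \<le> M"
  shows "reduced_bessel \<nu> t
    \<le> M * ((m + 1) * reduced_bessel (\<nu> + 1) t + t\<^sup>2 * reduced_bessel (\<nu> + 2) t
            - \<gamma> * (t * reduced_bessel (\<nu> + 1) t))"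
proof -
  define J1 where "J1 = reduced_bessel (\<nu> + 1) t"
  define J2 where "J2 = reduced_bessel (\<nu> + 2) t"
  have "0 < 2 * (\<nu> + 2) * \<theta> / (1 - \<theta>)" using \<nu> \<theta> by simp
  then have X0: "X > 0" and t0: "t > 0" using X t by auto
  have J: "J1 \<ge> 0" "J2 \<ge> 0" unfolding J1_def J2_def using \<nu> by (auto intro: reduced_bessel_nonneg)
  have "2 * (\<nu> + 2) * \<theta> \<le> t * (1 - \<theta>)" using X t \<theta>
    by (simp add: pos_divide_le_eq) (smt (verit) mult_right_mono)
  then have thr: "\<theta> * (2 * (\<nu> + 2) + t) \<le> t" by (simp add: algebra_simps)
  have "J1 \<le> (2 * (\<nu> + 2) + t) * J2"
    using reduced_bessel_ratio[of "\<nu> + 1" t] \<nu> t0 unfolding J1_def J2_def by (simp add: algebra_simps)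
  then have "\<theta> * J1 \<le> \<theta> * (2 * (\<nu> + 2) + t) * J2" using \<theta> by (simp add: mult.assoc mult_left_mono)
  also have "\<dots> \<le> t * J2" using thr J by (intro mult_right_mono)
  finally have "t * (\<theta> * J1) \<le> t * (t * J2)" using t0 by (intro mult_left_mono) auto
  moreover have "(m + 1) * J1 \<ge> 0" using m J by simp
  ultimately have low: "(\<theta> - \<gamma>) * (t * J1) \<le> (m + 1) * J1 + t\<^sup>2 * J2 - \<gamma> * (t * J1)"
    by (simp add: algebra_simps power2_eq_square)
  have "X * (2 * \<nu> + 2) \<le> t * (2 * \<nu> + 2)" using t \<nu> by (intro mult_right_mono) auto
  then have "X * (t + 2 * \<nu> + 2) \<le> t * (X + 2 * \<nu> + 2)" by (simp only: distrib_left mult_ac)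
  moreover have "X + 2 * \<nu> + 2 > 0" "t + 2 * \<nu> + 2 > 0" using X0 t0 \<nu> by auto
  ultimately have "X / (X + 2 * \<nu> + 2) \<le> t / (t + 2 * \<nu> + 2)"
    by (simp only: pos_divide_le_eq times_divide_eq_left pos_le_divide_eq)
  moreover have "t / (t + 2 * \<nu> + 2) * reduced_bessel \<nu> t \<le> t * J1"
    using mult_left_mono[OF reduced_bessel_ratio[of \<nu> t], of t] \<nu> t0
    unfolding J1_def by (simp add: pos_divide_le_eq algebra_simps)
  ultimately have "X / (X + 2 * \<nu> + 2) * reduced_bessel \<nu> t \<le> t * J1"
    using reduced_bessel_nonneg[OF \<nu>, of t] by (meson mult_right_mono order_trans)
  then have "(\<theta> - \<gamma>) * (X / (X + 2 * \<nu> + 2) * reduced_bessel \<nu> t) \<le> (\<theta> - \<gamma>) * (t * J1)"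
    using \<gamma> by (intro mult_left_mono) auto
  moreover define b where "b = X / (X + 2 * \<nu> + 2) * (\<theta> - \<gamma>)"
  moreover define R where "R = (m + 1) * J1 + t\<^sup>2 * J2 - \<gamma> * (t * J1)"
  ultimately have le: "b * reduced_bessel \<nu> t \<le> R"
    using low by (simp add: mult_ac)
  have b: "b > 0" using X0 \<nu> \<gamma> by (simp add: b_def)
  have "0 \<le> b * reduced_bessel \<nu> t" using b reduced_bessel_nonneg[OF \<nu>, of t] by simp
  then have R: "R \<ge> 0" using le by linarith
  have "reduced_bessel \<nu> t \<le> 1 / b * R" using b le by (simp add: field_simps)
  also have "\<dots> \<le> M * R" using M R unfolding b_def by (rule mult_right_mono)
  finally show ?thesis unfolding R_def J1_def J2_def .
qed

section \<open>The weighted integral\<close>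

lemma integral_le_increment:
  fixes f P P' :: "real \<Rightarrow> real"
  assumes "a \<le> b" and cont: "continuous_on {a..b} P" and f: "f integrable_on {a..b}"
    and der: "\<And>t. a < t \<Longrightarrow> t < b \<Longrightarrow> (P has_real_derivative P' t) (at t)"
    and le: "\<And>t. a < t \<Longrightarrow> t < b \<Longrightarrow> f t \<le> P' t"
  shows "integral {a..b} f \<le> P b - P a"
proof -
  have P': "(P' has_integral (P b - P a)) {a..b}"
    using assms(1) cont der
    by (intro fundamental_theorem_of_calculus_interior)
      (auto simp: has_real_derivative_iff_has_vector_derivative)
  have "integral {a<..<b} f \<le> integral {a<..<b} P'"
    using f P' le by (intro integral_le) (auto simp: integrable_on_open_interval_real has_integral_iff)
  then show ?thesis using P' by (simp add: integral_open_interval_real has_integral_iff)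
qed

text \<open>
  For \<open>m < 0\<close> the integrand may be unbounded at \<open>0\<close>; it is dominated by a multiple of \<open>t\<^sup>m\<close>, because
  the other two factors are continuous on the closed interval.
\<close>

lemma set_integrable_weighted_reduced_bessel:
  fixes \<nu> m \<gamma> x :: real
  assumes \<nu>: "\<nu> > -1" and m: "m > -1" and x: "x > 0"
  shows "set_integrable lborel {0<..<x} (\<lambda>t. exp (- \<gamma> * t) * t powr m * reduced_bessel \<nu> t)"
proof -
  have cont: "continuous_on S (\<lambda>t. exp (- \<gamma> * t) * reduced_bessel \<nu> t)" for S
    by (intro continuous_intros continuous_on_reduced_bessel \<nu>)
  have "bounded ((\<lambda>t. exp (- \<gamma> * t) * reduced_bessel \<nu> t) ` {0..x})"
    by (intro compact_imp_bounded compact_continuous_image cont compact_Icc)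
  then obtain B where "\<forall>t\<in>{0..x}. norm (exp (- \<gamma> * t) * reduced_bessel \<nu> t) \<le> B"
    unfolding bounded_iff by blast
  then have B: "\<bar>exp (- \<gamma> * t) * reduced_bessel \<nu> t\<bar> \<le> B" if "t \<in> {0..x}" for t
    using that by simp
  have [measurable]: "reduced_bessel \<nu> \<in> borel_measurable borel"
    by (intro borel_measurable_continuous_onI continuous_on_reduced_bessel \<nu>)
  have "(\<lambda>t. t powr m) integrable_on {0<..<x}"
    using integrable_on_powr_from_0[of m x] m x by (simp add: integrable_on_open_interval_real)
  then have "(\<lambda>t. t powr m) absolutely_integrable_on {0<..<x}"
    by (intro nonnegative_absolutely_integrable_1) auto
  then have "set_integrable lborel {0<..<x} (\<lambda>t. t powr m)"
    unfolding set_integrable_def by (subst (asm) integrable_completion) auto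
  then have "set_integrable lborel {0<..<x} (\<lambda>t. B * t powr m)"
    by (rule set_integrable_mult_right)
  then show ?thesis
  proof (rule set_integrable_bound)
    show "set_borel_measurable lborel {0<..<x} (\<lambda>t. exp (- \<gamma> * t) * t powr m * reduced_bessel \<nu> t)"
      unfolding set_borel_measurable_def by measurable
    have "\<bar>exp (- \<gamma> * t) * t powr m * reduced_bessel \<nu> t\<bar> \<le> \<bar>B * t powr m\<bar>" if "t \<in> {0<..<x}" for t
    proof -
      have "\<bar>exp (- \<gamma> * t) * reduced_bessel \<nu> t\<bar> * t powr m \<le> B * t powr m"
        using B[of t] that by (intro mult_right_mono) auto
      moreover have "\<bar>exp (- \<gamma> * t) * t powr m * reduced_bessel \<nu> t\<bar>
          = \<bar>exp (- \<gamma> * t) * reduced_bessel \<nu> t\<bar> * t powr m"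
        by (simp add: abs_mult)
      ultimately show ?thesis using abs_ge_self[of "B * t powr m"] by linarith
    qed
    then show "AE t in lborel. t \<in> {0<..<x} \<longrightarrow>
        norm (exp (- \<gamma> * t) * t powr m * reduced_bessel \<nu> t) \<le> norm (B * t powr m)"
      by auto
  qed
qed

lemma integrable_on_weighted_reduced_bessel:
  fixes \<nu> m \<gamma> x :: real
  assumes "\<nu> > -1" and "m > -1" and "x > 0"
  shows "(\<lambda>t. exp (- \<gamma> * t) * t powr m * reduced_bessel \<nu> t) integrable_on {0..x}"
  using set_borel_integral_eq_integral(1)[OF set_integrable_weighted_reduced_bessel[OF assms, of \<gamma>]]
  by (simp add: integrable_on_open_interval_real)

lemma continuous_on_powr_reduced_bessel:
  fixes a p :: real
  assumes "a > -1" "p > 0"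
  shows "continuous_on {0..} (\<lambda>t. t powr p * reduced_bessel a t)"
  using assms by (intro continuous_intros continuous_on_powr' continuous_on_reduced_bessel) auto

text \<open>
  The weight is first dropped, by \<open>e\<^sup>-\<^sup>\<gamma>\<^sup>t \<le> 1\<close>, and then restored at the endpoint, where
  \<open>1 \<le> e\<^sup>\<gamma>\<^sup>X e\<^sup>-\<^sup>\<gamma>\<^sup>x\<close> because \<open>x \<le> X\<close>.
\<close>

lemma integral_near:
  fixes \<nu> m \<gamma> X x :: real
  assumes \<nu>: "\<nu> > -1" and m: "m > -1" and \<gamma>: "\<gamma> > 0" and x: "0 < x" "x \<le> X"
  shows "integral {0..x} (\<lambda>t. exp (- \<gamma> * t) * t powr m * reduced_bessel \<nu> t)
    \<le> K_const \<nu> m * exp (\<gamma> * X) * (exp (- \<gamma> * x) * (x powr (m + 1) * reduced_bessel (\<nu> + 1) x))"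
proof -
  define P where "P = (\<lambda>t. t powr (m + 1) * reduced_bessel (\<nu> + 1) t)"
  have "integral {0..x} (\<lambda>t. exp (- \<gamma> * t) * t powr m * reduced_bessel \<nu> t)
      \<le> K_const \<nu> m * P x - K_const \<nu> m * P 0"
  proof (rule integral_le_increment[where P = "\<lambda>t. K_const \<nu> m * P t"])
    show "continuous_on {0..x} (\<lambda>t. K_const \<nu> m * P t)"
      unfolding P_def using \<nu> m
      by (intro continuous_on_mult_left continuous_on_subset[OF continuous_on_powr_reduced_bessel]) auto
    show "((\<lambda>t. K_const \<nu> m * P t) has_real_derivative K_const \<nu> m * (t powr m *
        ((m + 1) * reduced_bessel (\<nu> + 1) t + t\<^sup>2 * reduced_bessel (\<nu> + 2) t))) (at t)"
      if "0 < t" for t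
      unfolding P_def by (intro DERIV_cmult has_real_derivative_powr_reduced_bessel \<nu> that)
    show "exp (- \<gamma> * t) * t powr m * reduced_bessel \<nu> t \<le> K_const \<nu> m * (t powr m *
        ((m + 1) * reduced_bessel (\<nu> + 1) t + t\<^sup>2 * reduced_bessel (\<nu> + 2) t))"
      if "0 < t" for t
    proof -
      have "exp (- \<gamma> * t) * (t powr m * reduced_bessel \<nu> t) \<le> 1 * (t powr m * reduced_bessel \<nu> t)"
        using \<gamma> that reduced_bessel_nonneg[OF \<nu>] by (intro mult_right_mono) auto
      also have "\<dots> \<le> t powr m * (K_const \<nu> m *
          ((m + 1) * reduced_bessel (\<nu> + 1) t + t\<^sup>2 * reduced_bessel (\<nu> + 2) t))"
        using derivative_dominates_near[OF \<nu> m] by (simp add: mult_left_mono)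
      finally show ?thesis by (simp add: mult_ac)
    qed
  qed (use x integrable_on_weighted_reduced_bessel[OF \<nu> m] in auto)
  also have "\<dots> = K_const \<nu> m * P x * 1" by (simp add: P_def)
  also have "\<dots> \<le> K_const \<nu> m * P x * exp (\<gamma> * X - \<gamma> * x)"
    using \<gamma> x \<nu> reduced_bessel_nonneg[of "\<nu> + 1" x]
    by (intro mult_left_mono mult_nonneg_nonneg) (auto simp: P_def K_const_def)
  also have "exp (\<gamma> * X - \<gamma> * x) = exp (\<gamma> * X) * exp (- \<gamma> * x)"
    by (simp add: exp_add[symmetric])
  finally show ?thesis by (simp add: P_def mult_ac)
qed

text \<open>
  Any \<open>X \<ge> 2(\<nu>+2)\<theta>/(1-\<theta>)\<close> may serve as the point where the two estimates meet; past it
  \<open>M e\<^sup>-\<^sup>\<gamma>\<^sup>t P(t)\<close> grows at least as fast as the integral, which it already majorises at \<open>X\<close>.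
\<close>

lemma integral_weighted_reduced_bessel_le:
  fixes \<nu> m \<gamma> \<theta> X M x :: real
  assumes \<nu>: "\<nu> > -1" and m: "m > -1" and \<gamma>: "0 < \<gamma>" "\<gamma> < \<theta>" and \<theta>: "\<theta> < 1"
    and X: "2 * (\<nu> + 2) * \<theta> / (1 - \<theta>) \<le> X"
    and M1: "K_const \<nu> m * exp (\<gamma> * X) \<le> M"
    and M2: "1 / (X / (X + 2 * \<nu> + 2) * (\<theta> - \<gamma>)) \<le> M"
    and x: "x > 0"
  shows "integral {0..x} (\<lambda>t. exp (- \<gamma> * t) * t powr m * reduced_bessel \<nu> t)
    \<le> M * (exp (- \<gamma> * x) * (x powr (m + 1) * reduced_bessel (\<nu> + 1) x))"
proof -
  define f where "f = (\<lambda>t. exp (- \<gamma> * t) * t powr m * reduced_bessel \<nu> t)"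
  define Q where "Q = (\<lambda>t. exp (- \<gamma> * t) * (t powr (m + 1) * reduced_bessel (\<nu> + 1) t))"
  have "0 < 2 * (\<nu> + 2) * \<theta> / (1 - \<theta>)" using \<nu> \<gamma> \<theta> by simp
  then have X0: "X > 0" using X by linarith
  have near: "integral {0..y} f \<le> M * Q y" if "0 < y" "y \<le> X" for y
  proof -
    have "Q y \<ge> 0" unfolding Q_def using \<nu> by (simp add: reduced_bessel_nonneg)
    with M1 have "K_const \<nu> m * exp (\<gamma> * X) * Q y \<le> M * Q y" by (rule mult_right_mono)
    with integral_near[OF \<nu> m \<gamma>(1) that] show ?thesis unfolding f_def Q_def by linarith
  qed
  show ?thesis
  proof (cases "x \<le> X")
    case True
    with near[OF x] show ?thesis by (simp add: f_def Q_def)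
  next
    case False
    have int: "f integrable_on {0..x}"
      unfolding f_def by (rule integrable_on_weighted_reduced_bessel[OF \<nu> m x])
    have "integral {X..x} f \<le> M * Q x - M * Q X"
    proof (rule integral_le_increment[where P = "\<lambda>t. M * Q t"])
      show "f integrable_on {X..x}"
        using X0 by (intro integrable_on_subinterval[OF int]) auto
      show "continuous_on {X..x} (\<lambda>t. M * Q t)"
        unfolding Q_def using \<nu> m X0
        by (intro continuous_intros continuous_on_subset[OF continuous_on_powr_reduced_bessel]) auto
      fix t assume t: "X < t" "t < x"
      define D where "D = (m + 1) * reduced_bessel (\<nu> + 1) t + t\<^sup>2 * reduced_bessel (\<nu> + 2) t"
      have t0: "t > 0" using t X0 by linarith
      have "((\<lambda>t. exp (- \<gamma> * t)) has_real_derivative (- \<gamma> * exp (- \<gamma> * t))) (at t)"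
        by (auto intro!: derivative_eq_intros)
      from DERIV_mult[OF this has_real_derivative_powr_reduced_bessel[OF \<nu> t0, of m]]
      have "(Q has_real_derivative exp (- \<gamma> * t) * t powr m *
          (D - \<gamma> * (t * reduced_bessel (\<nu> + 1) t))) (at t)"
        unfolding Q_def D_def using t0 by (simp add: powr_add algebra_simps)
      then show "((\<lambda>t. M * Q t) has_real_derivative M * (exp (- \<gamma> * t) * t powr m *
          ((m + 1) * reduced_bessel (\<nu> + 1) t + t\<^sup>2 * reduced_bessel (\<nu> + 2) t
            - \<gamma> * (t * reduced_bessel (\<nu> + 1) t)))) (at t)"
        unfolding D_def by (rule DERIV_cmult)
      have "reduced_bessel \<nu> t \<le> M * (D - \<gamma> * (t * reduced_bessel (\<nu> + 1) t))"
        unfolding D_def using \<gamma> \<theta> t X M2 by (intro derivative_dominates_far[OF \<nu> m, of \<gamma> \<theta> X]) auto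
      then have "exp (- \<gamma> * t) * t powr m * reduced_bessel \<nu> t
          \<le> exp (- \<gamma> * t) * t powr m * (M * (D - \<gamma> * (t * reduced_bessel (\<nu> + 1) t)))"
        by (intro mult_left_mono) auto
      then show "f t \<le> M * (exp (- \<gamma> * t) * t powr m *
          ((m + 1) * reduced_bessel (\<nu> + 1) t + t\<^sup>2 * reduced_bessel (\<nu> + 2) t
            - \<gamma> * (t * reduced_bessel (\<nu> + 1) t)))"
        unfolding f_def D_def by (simp only: mult_ac)
    qed (use False in auto)
    moreover have "integral {0..X} f + integral {X..x} f = integral {0..x} f"
      using int X0 False by (intro Henstock_Kurzweil_Integration.integral_combine) auto
    ultimately show ?thesis using near[OF X0] by (simp add: f_def Q_def)
  qed
qed

theorem corollary5p2:
  fixes \<nu> m \<gamma> \<theta> :: real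
  assumes "\<nu> > -1" and "m > -1" and "0 < \<gamma>" and "\<gamma> < 1" and "\<gamma> < \<theta>" and "\<theta> < 1"
  shows "(\<forall>x>0.
            set_integrable lborel {0<..<x}
              (\<lambda>t. exp (- \<gamma> * t) * t powr m * (bessel_I \<nu> t / t powr \<nu>))
          \<and> (LBINT t:{0<..<x}. exp (- \<gamma> * t) * t powr m * (bessel_I \<nu> t / t powr \<nu>))
              \<le> M_const \<nu> m \<gamma> \<theta> * exp (- \<gamma> * x) * x powr m * (bessel_I (\<nu> + 1) x / x powr \<nu>))
       \<and> (m \<ge> 0 \<longrightarrow>
            M_const \<nu> m \<gamma> \<theta> =
              max (K_const \<nu> m * exp (2 * \<gamma> * (\<nu> + 2) * \<theta> / (1 - \<theta>)))
                  ((\<nu> + 1 + \<theta>) / ((\<nu> + 2) * \<theta> * (\<theta> - \<gamma>))))"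
proof (intro conjI allI impI)
  fix x :: real assume x: "x > 0"
  define f where "f = (\<lambda>t. exp (- \<gamma> * t) * t powr m * reduced_bessel \<nu> t)"
  have eq: "exp (- \<gamma> * t) * t powr m * (bessel_I \<nu> t / t powr \<nu>) = f t" if "t \<in> {0<..<x}" for t
    using that assms by (simp add: bessel_I_eq_reduced_bessel f_def)
  have f: "set_integrable lborel {0<..<x} f"
    unfolding f_def using assms x by (intro set_integrable_weighted_reduced_bessel)
  also have "set_integrable lborel {0<..<x} f \<longleftrightarrow> set_integrable lborel {0<..<x}
      (\<lambda>t. exp (- \<gamma> * t) * t powr m * (bessel_I \<nu> t / t powr \<nu>))"
    using eq by (intro set_integrable_cong) auto
  finally show "set_integrable lborel {0<..<x}
      (\<lambda>t. exp (- \<gamma> * t) * t powr m * (bessel_I \<nu> t / t powr \<nu>))" .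
  have "(LBINT t:{0<..<x}. exp (- \<gamma> * t) * t powr m * (bessel_I \<nu> t / t powr \<nu>))
      = (LBINT t:{0<..<x}. f t)"
    using eq by (intro set_lebesgue_integral_cong) auto
  also have "\<dots> = integral {0..x} f"
    using set_borel_integral_eq_integral(2)[OF f] by (simp add: integral_open_interval_real)
  also have "\<dots> \<le> M_const \<nu> m \<gamma> \<theta> * (exp (- \<gamma> * x) * (x powr (m + 1) * reduced_bessel (\<nu> + 1) x))"
    unfolding f_def
  proof (rule integral_weighted_reduced_bessel_le[where X = "X_const \<nu> m \<theta>"])
    show "2 * (\<nu> + 2) * \<theta> / (1 - \<theta>) \<le> X_const \<nu> m \<theta>"
      by (simp add: X_const_def)
    show "K_const \<nu> m * exp (\<gamma> * X_const \<nu> m \<theta>) \<le> M_const \<nu> m \<gamma> \<theta>"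
      by (simp add: M_const_def)
    show "1 / (X_const \<nu> m \<theta> / (X_const \<nu> m \<theta> + 2 * \<nu> + 2) * (\<theta> - \<gamma>)) \<le> M_const \<nu> m \<gamma> \<theta>"
      unfolding M_const_def beta_const_def by (rule max.cobounded2)
  qed (use assms x in auto)
  also have "\<dots> = M_const \<nu> m \<gamma> \<theta> * exp (- \<gamma> * x) * x powr m * (bessel_I (\<nu> + 1) x / x powr \<nu>)"
    using x assms by (simp add: bessel_I_eq_reduced_bessel powr_add)
  finally show "(LBINT t:{0<..<x}. exp (- \<gamma> * t) * t powr m * (bessel_I \<nu> t / t powr \<nu>))
      \<le> M_const \<nu> m \<gamma> \<theta> * exp (- \<gamma> * x) * x powr m * (bessel_I (\<nu> + 1) x / x powr \<nu>)" .
next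
  assume m: "m \<ge> 0"
  have X: "X_const \<nu> m \<theta> = 2 * (\<nu> + 2) * \<theta> / (1 - \<theta>)" using m by (simp add: X_const_def)
  have "X_const \<nu> m \<theta> + 2 * \<nu> + 2 = 2 * (\<nu> + 1 + \<theta>) / (1 - \<theta>)"
    unfolding X using assms by (simp add: field_simps)
  then have "beta_const \<nu> m \<theta> = (\<nu> + 2) * \<theta> / (\<nu> + 1 + \<theta>)"
    unfolding beta_const_def using assms by (simp add: X) (simp add: divide_simps, simp add: algebra_simps)
  then show "M_const \<nu> m \<gamma> \<theta> = max (K_const \<nu> m * exp (2 * \<gamma> * (\<nu> + 2) * \<theta> / (1 - \<theta>)))
      ((\<nu> + 1 + \<theta>) / ((\<nu> + 2) * \<theta> * (\<theta> - \<gamma>)))"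
    unfolding M_const_def X by (simp add: mult_ac)
qed

end
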